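(* Let $m>1$ be an integer, $\beta\in(0,1]$, $\tau\in[0,1)$. Suppose $\mathbb{P}_e(x(0))$ has a feasible solution. Run the scheme described in the context: $\zeta_0=V_{\max}$, $\xi_t=V_{\max}$ for $t\in\{0,\dots,m-1\}$, $\zeta_t$ ($t\ge1$) and $\xi_t$ ($t\ge m$) are updated by $$\zeta_t=V^\delta(x(t-1),\mathbf{u}^*_{t-1})-\beta J^\delta(x(t-1),\mathbf{u}^*_{t-1}),\qquad \xi_t=\max\{\tau\xi_{t-m},\zeta_{t-m+1}\},$$ where $\mathbf{u}^*_t=(u^*_{0|t},\dots,u^*_{N-1|t})$ is an optimal solution of $\mathbb{P}^m_e(x(t),\xi_t,\zeta_t)$, and the control $u(t)=u^*_{0|t}$ is applied, i.e. $x(t+1)=f(x(t),u^*_{0|t})$. Then: (i) $\mathbb{P}^m_e(x(t),\xi_t,\zeta_t)$ is feasible for all $t\ge0$; (ii) $\lim_{t\to\infty}V^\delta(x(t),\mathbf{u}^*_t)=0$ and $\lim_{t\to\infty}J^\delta(x(t),\mathbf{u}^*_t)=0$; (iii) the closed-loop state converges asymptotically to $x_s$, i.e. $\lim_{t\to\infty}x(t)=x_s$.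
   Context: Positive definiteness: a nonnegative function is positive definite with respect to a point if it is continuous, vanishes at that point, and is strictly positive at every other point of its domain. System and standing assumptions: $f:\mathbb{R}^{n_x}\times\mathbb{R}^{n_u}\to\mathbb{R}^{n_x}$ and $l_e:\mathbb{R}^{n_x}\times\mathbb{R}^{n_u}\to\mathbb{R}$ (economic cost) are continuous; the system is $x(t+1)=f(x(t),u(t))$, $t=0,1,2,\dots$, with constraints $x(t)\in X$, $u(t)\in U$, where $X\subseteq\mathbb{R}^{n_x}$ and $U\subseteq\mathbb{R}^{n_u}$ are compact; the state is measured. $X_\infty\subseteq X$ is a given set and $(x_s,u_s)$ is a minimizer of $l_e(x,u)$ subject to $x=f(x,u)$, $x\in X_\infty$, $u\in U$ (this problem is feasible); $x_s$ and $u_s$ lie in the interiors of $X$ and $U$. There are a compact terminal set $X_f\subseteq X$ containing $x_s$ in its interior and a map $\kappa_f:X\to U$ with $\kappa_f(x_s)=u_s$ and $f(x,\kappa_f(x))\in X_f$, $\kappa_f(x)\in U$ for all $x\in X_f$. The horizon length is an integer $N\ge1$. Tracking costs: $l$ (stage cost, a function of $(x,u)$) and $\delta:X\times U\to\mathbb{R}$ are positive definite with respect to $(x_s,u_s)$; $l_f$ (terminal cost, a function of $x$) and $\gamma:X\to[0,\infty)$ are positive definite with respect to $x_s$. For every $x\in X_f$, $$l_f(f(x,\kappa_f(x)))-l_f(x)\le -l(x,\kappa_f(x))-(N-1)\delta(x,\kappa_f(x))-\gamma(x).$$ Notation: for $x$ and $\mathbf{u}=(u_0,\dots,u_{N-1})$,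 the predicted states are $x_0=x$, $x_{k+1}=f(x_k,u_k)$. $\mathcal{U}(x)$ is the set of $\mathbf{u}$ such that $x_k\in X$, $u_k\in U$ for $k=0,\dots,N-1$ and $x_N\in X_f$. Define $$V^\delta(x,\mathbf{u})=\sum_{k=0}^{N-1}\big(l(x_k,u_k)+k\,\delta(x_k,u_k)\big)+l_f(x_N),$$ $$J^\delta(x,\mathbf{u})=l(x_0,u_0)+\sum_{k=1}^{N-1}\delta(x_k,u_k)+\gamma(x_N),$$ $$V_e(x,\mathbf{u})=\sum_{k=0}^{N-1}l_e(x_k,u_k),\qquad V_{\max}=\max\{V^\delta(x,\mathbf{u}):x\in X,\ \mathbf{u}\in\mathcal{U}(x)\}.$$ Optimization problems: $\mathbb{P}_e(x)$: minimize $V_e(x,\mathbf{u})$ over $\mathbf{u}\in\mathcal{U}(x)$. $\mathbb{P}^m_e(x,\xi,\zeta)$: minimize $V_e(x,\mathbf{u})$ over $\mathbf{u}\in\mathcal{U}(x)$ subject to $V^\delta(x,\mathbf{u})\le\xi$ and $V^\delta(x,\mathbf{u})-\beta J^\delta(x,\mathbf{u})\le\zeta$. Scheme: at each time $t=0,1,2,\dots$, measure $x(t)$, set $\xi_t,\zeta_t$ as in the claim, solve $\mathbb{P}^m_e(x(t),\xi_t,\zeta_t)$, and apply the first control of an optimal solution. *)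

theory Defs
  imports "HOL-Analysis.Analysis"
begin

definition positive_definite_on ::
    "'a::topological_space set \<Rightarrow> ('a \<Rightarrow> real) \<Rightarrow> 'a \<Rightarrow> bool" where
  "positive_definite_on D g p \<longleftrightarrow>
     continuous_on D g \<and> (\<forall>x\<in>D. 0 \<le> g x) \<and> g p = 0 \<and> (\<forall>x\<in>D. x \<noteq> p \<longrightarrow> 0 < g x)"

primrec predicted :: "('x \<times> 'u \<Rightarrow> 'x) \<Rightarrow> 'x \<Rightarrow> (nat \<Rightarrow> 'u) \<Rightarrow> nat \<Rightarrow> 'x" where
  "predicted f x u 0 = x"
| "predicted f x u (Suc k) = f (predicted f x u k, u k)"

text \<open>A control sequence of length \<open>N\<close> is a function on \<open>{..<N}\<close>; using \<open>\<rightarrow>\<^sub>E\<close> (value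
  \<open>undefined\<close> outside \<open>{..<N}\<close>) makes this representation unique.\<close>

definition admissible ::
    "('x \<times> 'u \<Rightarrow> 'x) \<Rightarrow> 'x set \<Rightarrow> 'u set \<Rightarrow> 'x set \<Rightarrow> nat \<Rightarrow> 'x \<Rightarrow> (nat \<Rightarrow> 'u) set" where
  "admissible f X U Xf N x =
     {u \<in> {..<N} \<rightarrow>\<^sub>E U. (\<forall>k<N. predicted f x u k \<in> X) \<and> predicted f x u N \<in> Xf}"

definition V_delta ::
    "('x \<times> 'u \<Rightarrow> 'x) \<Rightarrow> nat \<Rightarrow> ('x \<times> 'u \<Rightarrow> real) \<Rightarrow> ('x \<times> 'u \<Rightarrow> real) \<Rightarrow> ('x \<Rightarrow> real)
      \<Rightarrow> 'x \<Rightarrow> (nat \<Rightarrow> 'u) \<Rightarrow> real" where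
  "V_delta f N l \<delta> lf x u =
     (\<Sum>k<N. l (predicted f x u k, u k) + real k * \<delta> (predicted f x u k, u k))
       + lf (predicted f x u N)"

definition J_delta ::
    "('x \<times> 'u \<Rightarrow> 'x) \<Rightarrow> nat \<Rightarrow> ('x \<times> 'u \<Rightarrow> real) \<Rightarrow> ('x \<times> 'u \<Rightarrow> real) \<Rightarrow> ('x \<Rightarrow> real)
      \<Rightarrow> 'x \<Rightarrow> (nat \<Rightarrow> 'u) \<Rightarrow> real" where
  "J_delta f N l \<delta> \<gamma> x u =
     l (predicted f x u 0, u 0) + (\<Sum>k=1..<N. \<delta> (predicted f x u k, u k))
       + \<gamma> (predicted f x u N)"

definition V_econ ::
    "('x \<times> 'u \<Rightarrow> 'x) \<Rightarrow> nat \<Rightarrow> ('x \<times> 'u \<Rightarrow> real) \<Rightarrow> 'x \<Rightarrow> (nat \<Rightarrow> 'u) \<Rightarrow> real" where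
  "V_econ f N le x u = (\<Sum>k<N. le (predicted f x u k, u k))"

text \<open>\<open>GREATEST\<close> rather than \<open>Max\<close>, since the set of values is in general infinite.\<close>

definition V_max ::
    "('x \<times> 'u \<Rightarrow> 'x) \<Rightarrow> 'x set \<Rightarrow> 'u set \<Rightarrow> 'x set \<Rightarrow> nat
      \<Rightarrow> ('x \<times> 'u \<Rightarrow> real) \<Rightarrow> ('x \<times> 'u \<Rightarrow> real) \<Rightarrow> ('x \<Rightarrow> real) \<Rightarrow> real" where
  "V_max f X U Xf N l \<delta> lf =
     (GREATEST v. v \<in> {V_delta f N l \<delta> lf x u | x u. x \<in> X \<and> u \<in> admissible f X U Xf N x})"

definition Pm_feasible_set ::
    "('x \<times> 'u \<Rightarrow> 'x) \<Rightarrow> 'x set \<Rightarrow> 'u set \<Rightarrow> 'x set \<Rightarrow> nat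
      \<Rightarrow> ('x \<times> 'u \<Rightarrow> real) \<Rightarrow> ('x \<times> 'u \<Rightarrow> real) \<Rightarrow> ('x \<Rightarrow> real) \<Rightarrow> ('x \<Rightarrow> real) \<Rightarrow> real
      \<Rightarrow> 'x \<Rightarrow> real \<Rightarrow> real \<Rightarrow> (nat \<Rightarrow> 'u) set" where
  "Pm_feasible_set f X U Xf N l \<delta> lf \<gamma> \<beta> x \<xi> \<zeta> =
     {u \<in> admissible f X U Xf N x.
        V_delta f N l \<delta> lf x u \<le> \<xi> \<and>
        V_delta f N l \<delta> lf x u - \<beta> * J_delta f N l \<delta> \<gamma> x u \<le> \<zeta>}"

definition Pm_optimal ::
    "('x \<times> 'u \<Rightarrow> 'x) \<Rightarrow> ('x \<times> 'u \<Rightarrow> real) \<Rightarrow> 'x set \<Rightarrow> 'u set \<Rightarrow> 'x set \<Rightarrow> nat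
      \<Rightarrow> ('x \<times> 'u \<Rightarrow> real) \<Rightarrow> ('x \<times> 'u \<Rightarrow> real) \<Rightarrow> ('x \<Rightarrow> real) \<Rightarrow> ('x \<Rightarrow> real) \<Rightarrow> real
      \<Rightarrow> 'x \<Rightarrow> real \<Rightarrow> real \<Rightarrow> (nat \<Rightarrow> 'u) \<Rightarrow> bool" where
  "Pm_optimal f le X U Xf N l \<delta> lf \<gamma> \<beta> x \<xi> \<zeta> u \<longleftrightarrow>
     is_arg_min (V_econ f N le x) (\<lambda>v. v \<in> Pm_feasible_set f X U Xf N l \<delta> lf \<gamma> \<beta> x \<xi> \<zeta>) u"

end

theory Submission
  imports Defs
begin

text \<open>Shifting an admissible control sequence by one step and appending \<open>\<kappa>\<^sub>f (x\<^sub>N)\<close> lowers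
  \<open>V\<^sup>\<delta>\<close> by at least \<open>J\<^sup>\<delta>\<close>, because every summand at stage \<open>k\<close> moves to stage \<open>k - 1\<close> and loses
  one copy of \<open>\<delta>\<close>. So the shifted sequence has value at most \<open>\<zeta>\<^sub>t\<^sub>+\<^sub>1\<close>; since \<open>\<zeta>\<close> is nonincreasing and
  \<open>m > 1\<close>, this is also at most \<open>\<xi>\<^sub>t\<^sub>+\<^sub>1\<close>. In the limit, \<open>\<zeta>\<close> decreases to some \<open>z \<ge> 0\<close>, and
  \<open>\<xi>\<^sub>t = max {\<tau> \<xi>\<^sub>t\<^sub>-\<^sub>m, \<zeta>\<^sub>t\<^sub>-\<^sub>m\<^sub>+\<^sub>1}\<close> with \<open>\<tau> < 1\<close> gives \<open>limsup \<xi> \<le> z\<close>. As \<open>\<zeta>\<^sub>t\<^sub>+\<^sub>1 \<le> V\<^sup>\<delta> \<le> \<xi>\<^sub>t\<close>,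
  also \<open>V\<^sup>\<delta>\<close> tends to \<open>z\<close>, hence \<open>\<beta> J\<^sup>\<delta> = V\<^sup>\<delta> - \<zeta>\<^sub>t\<^sub>+\<^sub>1\<close> tends to \<open>0\<close>. Positive definiteness on compact
  sets turns this into convergence of the whole prediction to the equilibrium, and so \<open>z = 0\<close>.\<close>

section \<open>Preliminaries: trajectories, positive definite functions, a delayed recursion\<close>

lemma predicted_cong:
  assumes "\<And>j. j < k \<Longrightarrow> u j = v j"
  shows "predicted f x u k = predicted f x v k"
  using assms by (induction k) auto

lemma predicted_Suc_shift:
  "predicted f (f (x, u 0)) (\<lambda>k. u (Suc k)) k = predicted f x u (Suc k)"
  by (induction k) auto

text \<open>Joint continuity in the initial state and the whole control sequence, under the product
  topology; it makes the state constraints closed conditions.\<close>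

lemma continuous_on_predicted:
  fixes f :: "'x::topological_space \<times> 'u::topological_space \<Rightarrow> 'x"
  assumes "continuous_on UNIV f"
  shows "continuous_on UNIV (\<lambda>(x, u). predicted f x u k)"
proof (induction k)
  case 0
  show ?case by (simp add: case_prod_unfold continuous_on_fst)
next
  case (Suc k)
  have "continuous_on UNIV (\<lambda>p::'x \<times> (nat \<Rightarrow> 'u). snd p k)"
    by (rule continuous_on_product_then_coordinatewise) (intro continuous_intros)
  with Suc show ?case
    by (auto simp: case_prod_unfold intro!: continuous_intros continuous_on_compose2[OF assms])
qed

text \<open>Fixing the value \<open>undefined\<close> outside \<open>I\<close> amounts to singleton
  factors there, so the set is a full product of compact sets and Tychonoff applies.\<close>

lemma compact_PiE:
  fixes U :: "'u::topological_space set"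
  assumes "compact U"
  shows "compact (I \<rightarrow>\<^sub>E U)"
proof -
  have "I \<rightarrow>\<^sub>E U = (\<Pi>\<^sub>E i\<in>UNIV. if i \<in> I then U else {undefined})"
    by (auto simp: PiE_def Pi_def extensional_def split: if_splits)
  moreover have "compactin (product_topology (\<lambda>i. euclidean) UNIV)
      (\<Pi>\<^sub>E i\<in>UNIV. if i \<in> I then U else {undefined::'u})"
    using assms by (subst compactin_PiE) auto
  ultimately show ?thesis
    by (simp add: euclidean_product_topology)
qed

text \<open>Outside a ball around \<open>p\<close>, compactness gives \<open>g\<close> a positive
  minimum; once \<open>g (z t)\<close> falls below it, \<open>z t\<close> must lie in the
  ball.\<close>

lemma positive_definite_on_tendsto:
  fixes z :: "nat \<Rightarrow> 'a::metric_space"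
  assumes pd: "positive_definite_on K g p" and K: "compact K"
    and z: "\<And>t. z t \<in> K" and lim: "(\<lambda>t. g (z t)) \<longlonglongrightarrow> 0"
  shows "z \<longlonglongrightarrow> p"
proof (rule tendstoI)
  fix e :: real assume "e > 0"
  define C where "C = K - ball p e"
  have C: "compact C" unfolding C_def by (intro compact_diff K) simp
  show "eventually (\<lambda>t. dist (z t) p < e) sequentially"
  proof (cases "C = {}")
    case True
    then have "dist (z t) p < e" for t using z[of t] by (auto simp: C_def dist_commute)
    then show ?thesis by simp
  next
    case False
    have "continuous_on C g"
      using pd by (auto simp: positive_definite_on_def C_def intro: continuous_on_subset)
    from continuous_attains_inf[OF C False this]
    obtain c where c: "c \<in> C" "\<And>y. y \<in> C \<Longrightarrow> g c \<le> g y" by blast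
    have "g c > 0" using c(1) pd \<open>e > 0\<close> by (auto simp: positive_definite_on_def C_def)
    with lim have "eventually (\<lambda>t. g (z t) < g c) sequentially" by (rule order_tendstoD)
    then show ?thesis
    proof eventually_elim
      case (elim t)
      then have "z t \<notin> C" using c(2) by force
      then show ?case using z[of t] by (auto simp: C_def dist_commute)
    qed
  qed
qed

lemma positive_definite_on_compose_tendsto:
  assumes "positive_definite_on K g p" and "p \<in> K" and "\<And>t. z t \<in> K" and "z \<longlonglongrightarrow> p"
  shows "(\<lambda>t. g (z t)) \<longlonglongrightarrow> 0"
  using assms continuous_on_tendsto_compose[of K g z p sequentially]
  by (auto simp: positive_definite_on_def)

text \<open>Once \<open>\<zeta>\<close> is small, each delay of \<open>m\<close> steps contracts the
  remaining bound on \<open>\<xi>\<close> by the factor \<open>\<tau>\<close>.\<close>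

lemma delayed_max_recursion_eventually_less:
  fixes \<xi> \<zeta> :: "nat \<Rightarrow> real"
  assumes \<xi>: "\<And>t. t \<ge> m \<Longrightarrow> \<xi> t = max (\<tau> * \<xi> (t - m)) (\<zeta> (t - m + 1))"
    and "m > 0" and \<tau>: "0 \<le> \<tau>" "\<tau> < 1"
    and \<zeta>: "\<zeta> \<longlonglongrightarrow> z" and "z < c" and "0 < c"
  shows "eventually (\<lambda>t. \<xi> t < c) sequentially"
proof -
  \<comment> \<open>The room below \<open>c\<close> makes the final inequality strict; positivity of
    \<open>b\<close> gives \<open>\<tau> * b \<le> b\<close> and lets \<open>\<tau> ^ j * B\<close>
    drop below \<open>b\<close>.\<close>
  obtain b where "z < b" "b < c" "0 < b"
    using \<open>z < c\<close> \<open>0 < c\<close> dense[of "max z 0" c] by auto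
  obtain T where T: "\<And>t. t \<ge> T \<Longrightarrow> \<zeta> t < b"
    using order_tendstoD(2)[OF \<zeta> \<open>z < b\<close>] by (auto simp: eventually_sequentially)
  obtain K where K: "\<And>t. \<bar>\<zeta> t\<bar> \<le> K"
    using convergent_imp_Bseq[OF convergentI[OF \<zeta>]] by (auto simp: Bseq_def)
  \<comment> \<open>Including \<open>K\<close> makes \<open>B\<close> nonnegative, so
    \<open>\<tau> * B \<le> B\<close>, and lets \<open>B\<close> dominate every
    \<open>\<zeta> t\<close>.\<close>
  define B where "B = Max (insert K (\<xi> ` {..<m}))"
  have KB: "K \<le> B" and \<xi>m: "t < m \<Longrightarrow> \<xi> t \<le> B" for t
    by (auto simp: B_def)
  have "0 \<le> K" using K[of 0] by linarith
  have B: "\<xi> t \<le> B" for t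
  proof (induction t rule: less_induct)
    case (less t)
    show ?case
    proof (cases "t < m")
      case False
      have "\<tau> * \<xi> (t - m) \<le> \<tau> * B"
        using less[of "t - m"] False \<open>m > 0\<close> \<tau> by (intro mult_left_mono) auto
      also have "\<dots> \<le> B" using \<tau> KB \<open>0 \<le> K\<close> by (simp add: mult_left_le_one_le)
      finally show ?thesis using \<xi>[of t] False K[of "t - m + 1"] KB by auto
    qed (rule \<xi>m)
  qed
  \<comment> \<open>\<open>j\<close> counts the full delays elapsed since \<open>T\<close>.\<close>
  have bound: "\<xi> t \<le> max (\<tau> ^ j * B) b" if "t \<ge> T + j * m" for j t
    using that
  proof (induction j arbitrary: t)
    case 0
    then show ?case using B[of t] by simp
  next
    case (Suc j)
    then have t: "t \<ge> m" "t - m \<ge> T + j * m" by auto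
    have "\<tau> * \<xi> (t - m) \<le> \<tau> * max (\<tau> ^ j * B) b"
      using Suc.IH[OF t(2)] \<tau> by (intro mult_left_mono)
    also have "\<dots> = max (\<tau> ^ Suc j * B) (\<tau> * b)"
      using \<tau> by (simp add: max_mult_distrib_left mult.assoc)
    also have "\<dots> \<le> max (\<tau> ^ Suc j * B) b"
      using \<tau> \<open>0 < b\<close> by (intro max.mono) (auto simp: mult_left_le_one_le)
    finally show ?case using \<xi>[OF t(1)] T[of "t - m + 1"] t by auto
  qed
  have "(\<lambda>j. \<tau> ^ j * B) \<longlonglongrightarrow> 0"
    using \<tau> by (intro tendsto_mult_left_zero LIMSEQ_realpow_zero)
  from eventually_happens[OF order_tendstoD(2)[OF this \<open>0 < b\<close>]]
  obtain j where "\<tau> ^ j * B < b" by auto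
  then have "\<xi> t < c" if "t \<ge> T + j * m" for t
    using bound[OF that] \<open>b < c\<close> by auto
  then show ?thesis by (auto simp: eventually_sequentially)
qed

section \<open>The shifted candidate and the descent of the tracking cost\<close>

locale tracking_mpc =
  fixes f :: "'x::metric_space \<times> 'u::metric_space \<Rightarrow> 'x"
    and l \<delta> :: "'x \<times> 'u \<Rightarrow> real" and lf \<gamma> :: "'x \<Rightarrow> real"
    and X Xf :: "'x set" and U :: "'u set" and xs :: 'x and us :: 'u
    and \<kappa> :: "'x \<Rightarrow> 'u" and N :: nat
  assumes f_cont: "continuous_on UNIV f"
    and X_compact: "compact X" and U_compact: "compact U"
    and Xf_compact: "compact Xf" and Xf_X: "Xf \<subseteq> X"
    and xs_Xf: "xs \<in> Xf" and us_U: "us \<in> U"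
    and terminal_invariant: "\<And>y. y \<in> Xf \<Longrightarrow> f (y, \<kappa> y) \<in> Xf \<and> \<kappa> y \<in> U"
    and N_pos: "N \<ge> 1"
    and l_pd: "positive_definite_on (X \<times> U) l (xs, us)"
    and \<delta>_pd: "positive_definite_on (X \<times> U) \<delta> (xs, us)"
    and lf_pd: "positive_definite_on Xf lf xs"
    and \<gamma>_pd: "positive_definite_on X \<gamma> xs"
    and terminal_decrease: "\<And>y. y \<in> Xf \<Longrightarrow> lf (f (y, \<kappa> y)) - lf y
            \<le> - l (y, \<kappa> y) - (real N - 1) * \<delta> (y, \<kappa> y) - \<gamma> y"
begin

abbreviation "pred \<equiv> predicted f"
abbreviation "adm \<equiv> admissible f X U Xf N"
abbreviation "V \<equiv> V_delta f N l \<delta> lf"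
abbreviation "J \<equiv> J_delta f N l \<delta> \<gamma>"
abbreviation "Vmax \<equiv> V_max f X U Xf N l \<delta> lf"

lemma admissible_stage:
  assumes "u \<in> adm x" "k < N"
  shows "(pred x u k, u k) \<in> X \<times> U"
  using assms by (auto simp: admissible_def PiE_def Pi_def)

lemma admissible_terminal: "u \<in> adm x \<Longrightarrow> pred x u N \<in> Xf"
  by (simp add: admissible_def)

lemma admissible_initial: "u \<in> adm x \<Longrightarrow> x \<in> X"
  using admissible_stage[of u x 0] N_pos by simp

lemma V_nonneg: "0 \<le> V x u" if "u \<in> adm x"
  unfolding V_delta_def
  using admissible_stage[OF that] admissible_terminal[OF that] l_pd \<delta>_pd lf_pd
  by (intro add_nonneg_nonneg sum_nonneg mult_nonneg_nonneg)
     (auto simp: positive_definite_on_def)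

lemma J_terms_nonneg:
  assumes "u \<in> adm x"
  shows "0 \<le> l (pred x u 0, u 0)" "k < N \<Longrightarrow> 0 \<le> \<delta> (pred x u k, u k)" "0 \<le> \<gamma> (pred x u N)"
  using admissible_stage[OF assms, of 0] admissible_stage[OF assms, of k] N_pos
    admissible_terminal[OF assms] Xf_X l_pd \<delta>_pd \<gamma>_pd
  by (auto simp: positive_definite_on_def)

lemma J_nonneg: "0 \<le> J x u" if "u \<in> adm x"
  unfolding J_delta_def using J_terms_nonneg[OF that]
  by (intro add_nonneg_nonneg sum_nonneg) auto

text \<open>Restricting to \<open>{..<N}\<close> keeps the value \<open>undefined\<close> beyond the
  horizon, as membership in \<open>adm\<close> demands.\<close>

definition shifted :: "'x \<Rightarrow> (nat \<Rightarrow> 'u) \<Rightarrow> nat \<Rightarrow> 'u" where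
  "shifted x u = (\<lambda>k\<in>{..<N}. if Suc k < N then u (Suc k) else \<kappa> (pred x u N))"

lemma shifted_simps:
  "Suc k < N \<Longrightarrow> shifted x u k = u (Suc k)"
  "Suc k = N \<Longrightarrow> shifted x u k = \<kappa> (pred x u N)"
  by (auto simp: shifted_def)

text \<open>The state at stage \<open>k < N\<close> depends only on controls before
  \<open>k\<close>, so the appended one is not yet involved, even at
  \<open>k = N - 1\<close>.\<close>

lemma predicted_shifted:
  assumes "k < N"
  shows "pred (f (x, u 0)) (shifted x u) k = pred x u (Suc k)"
proof -
  have "pred (f (x, u 0)) (shifted x u) k = pred (f (x, u 0)) (\<lambda>k. u (Suc k)) k"
    using assms by (intro predicted_cong) (simp add: shifted_def)
  then show ?thesis by (simp only: predicted_Suc_shift)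
qed

lemma predicted_shifted_terminal:
  "pred (f (x, u 0)) (shifted x u) N = f (pred x u N, \<kappa> (pred x u N))"
proof -
  obtain n where n: "Suc n = N" using N_pos by (cases N) auto
  then have "pred (f (x, u 0)) (shifted x u) n = pred x u N"
    using predicted_shifted[of n x u] by (simp del: predicted.simps)
  then show ?thesis
    using shifted_simps(2)[OF n] by (simp flip: n)
qed

lemma shifted_admissible:
  assumes u: "u \<in> adm x"
  shows "shifted x u \<in> adm (f (x, u 0))"
proof -
  have "pred x u (Suc k) \<in> X" if "k < N" for k
  proof (cases "Suc k < N")
    case False
    then have "Suc k = N" using that by simp
    then show ?thesis using admissible_terminal[OF u] Xf_X by auto
  qed (use admissible_stage[OF u, of "Suc k"] in auto)
  moreover have "shifted x u \<in> {..<N} \<rightarrow>\<^sub>E U"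
    using admissible_stage[OF u] terminal_invariant[OF admissible_terminal[OF u]]
    by (auto simp: shifted_def)
  ultimately show ?thesis
    using terminal_invariant[OF admissible_terminal[OF u]]
    by (auto simp: admissible_def predicted_shifted predicted_shifted_terminal
             simp del: predicted.simps)
qed

lemma V_shifted_le:
  assumes u: "u \<in> adm x"
  shows "V (f (x, u 0)) (shifted x u) \<le> V x u - J x u"
proof -
  obtain n where N: "N = Suc n" using N_pos by (cases N) auto
  define y where "y = pred x u N"
  define L where "L k = l (pred x u k, u k)" for k
  define D where "D k = \<delta> (pred x u k, u k)" for k
  have stage: "l (pred (f (x, u 0)) (shifted x u) k, shifted x u k)
        + real k * \<delta> (pred (f (x, u 0)) (shifted x u) k, shifted x u k)
      = L (Suc k) + real k * D (Suc k)" if "k < n" for k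
    using that N predicted_shifted[of k x u] shifted_simps(1)[of k x u] by (simp add: L_def D_def)
  have "V (f (x, u 0)) (shifted x u)
      = (\<Sum>k<n. L (Suc k) + real k * D (Suc k)) + l (y, \<kappa> y) + real n * \<delta> (y, \<kappa> y)
        + lf (f (y, \<kappa> y))"
    using predicted_shifted[of n x u] shifted_simps(2)[of n x u] stage
    unfolding V_delta_def predicted_shifted_terminal
    by (simp add: N y_def del: predicted.simps)
  \<comment> \<open>The appended stage has weight \<open>n = N - 1\<close> on
    \<open>\<delta>\<close>, exactly the coefficient in \<open>terminal_decrease\<close>, so the
    drop in \<open>lf\<close> pays for it and leaves \<open>- \<gamma> y\<close>.\<close>
  also have "\<dots> \<le> (\<Sum>k<n. L (Suc k) + real k * D (Suc k)) + lf y - \<gamma> y"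
    using terminal_decrease[OF admissible_terminal[OF u]] by (simp add: N y_def)
  \<comment> \<open>The weights on \<open>D (Suc k)\<close> differ by one; these differences,
    \<open>L 0\<close> and \<open>\<gamma> y\<close> make up \<open>J x u\<close>.\<close>
  also have "\<dots> = V x u - J x u"
  proof -
    have "V x u = L 0 + (\<Sum>k<n. L (Suc k) + real (Suc k) * D (Suc k)) + lf y"
      unfolding V_delta_def L_def D_def y_def N sum.lessThan_Suc_shift by simp
    moreover have "J x u = L 0 + (\<Sum>k<n. D (Suc k)) + \<gamma> y"
    proof -
      have "(\<Sum>k=1..<N. D k) = (\<Sum>k<n. D (Suc k))"
        unfolding N One_nat_def sum.atLeast_Suc_lessThan_Suc_shift
        by (simp add: lessThan_atLeast0 comp_def)
      then show ?thesis by (simp add: J_delta_def L_def D_def y_def)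
    qed
    ultimately show ?thesis by (simp add: algebra_simps sum.distrib)
  qed
  finally show ?thesis .
qed

section \<open>Compactness: the bound \<open>Vmax\<close>, and convergence forced by
  \<open>J\<close>\<close>

lemma V_le_V_max:
  assumes "u \<in> adm x"
  shows "V x u \<le> Vmax"
proof -
  \<comment> \<open>The maximum defining \<open>Vmax\<close> is attained by compactness in the product topology on
    control sequences; otherwise \<open>GREATEST\<close> would be unspecified.\<close>
  define P where "P k p = (case p of (x, u) \<Rightarrow> pred x u k)" for k p
  \<comment> \<open>The admissible pairs, written as preimages of closed sets under continuous maps
    inside a compact product.\<close>
  define S where "S = (X \<times> ({..<N} \<rightarrow>\<^sub>E U)) \<inter> (\<Inter>k\<in>{..<N}. P k -` X) \<inter> P N -` Xf"
  have P: "continuous_on A (P k)" for A k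
    unfolding P_def using continuous_on_predicted[OF f_cont] continuous_on_subset by blast
  have "closed (P k -` X)" "closed (P k -` Xf)" for k
    using closed_vimage[OF _ P] compact_imp_closed X_compact Xf_compact by blast+
  then have S: "compact S"
    unfolding S_def
    by (intro compact_Int_closed compact_Times X_compact compact_PiE U_compact) auto
  have S_iff: "(x, u) \<in> S \<longleftrightarrow> x \<in> X \<and> u \<in> adm x" for x u
    by (auto simp: S_def P_def admissible_def)
  have snd_cont: "continuous_on S (\<lambda>p. snd p k)" for k
    by (rule continuous_on_product_then_coordinatewise) (intro continuous_intros)
  have stage: "(P k p, snd p k) \<in> X \<times> U" if "p \<in> S" "k < N" for p k
    using that admissible_stage[of "snd p" "fst p" k] S_iff[of "fst p" "snd p"]
    by (auto simp: P_def case_prod_unfold)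
  \<comment> \<open>Continuity of \<open>g\<close> is given on \<open>X \<times> U\<close> only, so
    the stage pairs must be known to stay there.\<close>
  have cont: "continuous_on S (\<lambda>p. g (P k p, snd p k))"
    if "positive_definite_on (X \<times> U) g (xs, us)" "k < N" for g k
  proof (rule continuous_on_compose2[where g = g and f = "\<lambda>p. (P k p, snd p k)"])
    show "continuous_on (X \<times> U) g"
      using that(1) by (simp add: positive_definite_on_def)
    show "continuous_on S (\<lambda>p. (P k p, snd p k))"
      by (intro continuous_on_Pair P snd_cont)
    show "(\<lambda>p. (P k p, snd p k)) ` S \<subseteq> X \<times> U"
      using stage that(2) by blast
  qed
  have "continuous_on S (\<lambda>p. lf (P N p))"
    using lf_pd by (intro continuous_on_compose2[OF _ P, of Xf lf])
      (auto simp: positive_definite_on_def S_def)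
  then have "continuous_on S (\<lambda>p. (\<Sum>k<N. l (P k p, snd p k) + real k * \<delta> (P k p, snd p k))
      + lf (P N p))"
    using cont[OF l_pd] cont[OF \<delta>_pd] by (intro continuous_intros) auto
  then have "continuous_on S (\<lambda>(x, u). V x u)"
    by (simp add: V_delta_def P_def case_prod_unfold)
  moreover have xu: "(x, u) \<in> S" using assms admissible_initial S_iff by blast
  ultimately obtain q where q: "q \<in> S" "\<And>p. p \<in> S \<Longrightarrow> (case p of (x, u) \<Rightarrow> V x u) \<le> (case q of (x, u) \<Rightarrow> V x u)"
    using continuous_attains_sup[OF S, of "\<lambda>(x, u). V x u"] by blast
  obtain y v where yv: "q = (y, v)" by (cases q)
  have "Vmax = V y v"
    unfolding V_max_def using q S_iff yv by (intro Greatest_equality) auto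
  then show ?thesis using q(2)[OF xu] yv by simp
qed

text \<open>\<open>J\<close> controls \<open>l\<close> only at stage \<open>0\<close> and \<open>\<delta>\<close> only at stages \<open>k \<ge> 1\<close>; either of them
  forces the stage pair to converge, after which continuity handles the remaining terms of \<open>V\<close>.\<close>

lemma J_tendsto_zero_imp:
  assumes u: "\<And>t. u t \<in> adm (x t)" and J: "(\<lambda>t. J (x t) (u t)) \<longlonglongrightarrow> 0"
  shows "x \<longlonglongrightarrow> xs" and "(\<lambda>t. V (x t) (u t)) \<longlonglongrightarrow> 0"
proof -
  let ?z = "\<lambda>k t. (pred (x t) (u t) k, u t k)"
  let ?y = "\<lambda>t. pred (x t) (u t) N"
  note nonneg = J_terms_nonneg[OF u]
  have sum_nonneg': "0 \<le> (\<Sum>k=1..<N. \<delta> (?z k t))" for t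
    using nonneg by (intro sum_nonneg) auto
  \<comment> \<open>All terms of \<open>J\<close> are nonnegative, so \<open>J\<close> dominates
    each of them separately.\<close>
  have squeeze: "h \<longlonglongrightarrow> 0" if "\<And>t. 0 \<le> h t" "\<And>t. h t \<le> J (x t) (u t)" for h
    using that by (intro tendsto_sandwich[OF _ _ tendsto_const J]) auto
  have XU: "compact (X \<times> U)" "(xs, us) \<in> X \<times> U"
    using X_compact U_compact xs_Xf Xf_X us_U by (auto intro: compact_Times)
  have stage: "?z k t \<in> X \<times> U" if "k < N" for k t
    using admissible_stage[OF u that] .
  have l0: "(\<lambda>t. l (?z 0 t)) \<longlonglongrightarrow> 0"
    using nonneg sum_nonneg' by (intro squeeze) (auto simp: J_delta_def)
  have \<delta>0: "(\<lambda>t. \<delta> (?z k t)) \<longlonglongrightarrow> 0" if "k \<in> {1..<N}" for k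
  proof (rule squeeze)
    fix t
    have "\<delta> (?z k t) \<le> (\<Sum>k=1..<N. \<delta> (?z k t))"
      using nonneg that by (intro member_le_sum[where f = "\<lambda>k. \<delta> (?z k t)"]) auto
    then show "\<delta> (?z k t) \<le> J (x t) (u t)" using nonneg[of t] by (simp add: J_delta_def)
  qed (use nonneg that in auto)
  have "(\<lambda>t. \<gamma> (?y t)) \<longlonglongrightarrow> 0"
    using nonneg sum_nonneg' by (intro squeeze) (auto simp: J_delta_def)
  then have y: "?y \<longlonglongrightarrow> xs"
    using admissible_terminal[OF u] Xf_X
    by (intro positive_definite_on_tendsto[OF \<gamma>_pd X_compact]) auto
  have z: "?z k \<longlonglongrightarrow> (xs, us)" if "k < N" for k
  proof (cases "k = 0")
    case True
    show ?thesis
      using positive_definite_on_tendsto[OF l_pd XU(1) stage l0] that True by simp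
  next
    case False
    then show ?thesis
      using positive_definite_on_tendsto[OF \<delta>_pd XU(1) stage \<delta>0] that by simp
  qed
  show "x \<longlonglongrightarrow> xs"
    using tendsto_fst[OF z[of 0]] N_pos by simp
  have "(\<lambda>t. l (?z k t)) \<longlonglongrightarrow> 0" "(\<lambda>t. \<delta> (?z k t)) \<longlonglongrightarrow> 0" if "k < N" for k
    using positive_definite_on_compose_tendsto[OF l_pd XU(2) stage[OF that] z[OF that]]
      positive_definite_on_compose_tendsto[OF \<delta>_pd XU(2) stage[OF that] z[OF that]] by auto
  then have "(\<lambda>t. \<Sum>k<N. l (?z k t) + real k * \<delta> (?z k t)) \<longlonglongrightarrow> (\<Sum>k<N. 0 + real k * 0)"
    by (intro tendsto_intros) auto
  moreover have "(\<lambda>t. lf (?y t)) \<longlonglongrightarrow> 0"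
    using positive_definite_on_compose_tendsto[OF lf_pd xs_Xf admissible_terminal[OF u] y] .
  ultimately show "(\<lambda>t. V (x t) (u t)) \<longlonglongrightarrow> 0"
    unfolding V_delta_def using tendsto_add by fastforce
qed

end

section \<open>The closed loop: recursive feasibility and decay of \<open>J\<close>\<close>

locale tracking_mpc_run = tracking_mpc f l \<delta> lf \<gamma> X Xf U xs us \<kappa> N
  for f :: "'x::metric_space \<times> 'u::metric_space \<Rightarrow> 'x"
    and l \<delta> lf \<gamma> X Xf U xs us \<kappa> N +
  fixes m :: nat and \<beta> \<tau> :: real and x :: "nat \<Rightarrow> 'x" and u :: "nat \<Rightarrow> nat \<Rightarrow> 'u"
    and \<xi> \<zeta> :: "nat \<Rightarrow> real"
  assumes m: "m > 1" and \<beta>: "0 < \<beta>" "\<beta> \<le> 1" and \<tau>: "0 \<le> \<tau>" "\<tau> < 1"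
    and initial: "adm (x 0) \<noteq> {}"
    and closed_loop: "\<And>t. x (Suc t) = f (x t, u t 0)"
    and \<zeta>_0: "\<zeta> 0 = Vmax" and \<xi>_initial: "\<And>t. t < m \<Longrightarrow> \<xi> t = Vmax"
    and \<zeta>_Suc: "\<And>t. \<zeta> (Suc t) = V (x t) (u t) - \<beta> * J (x t) (u t)"
    and \<xi>_delayed: "\<And>t. t \<ge> m \<Longrightarrow> \<xi> t = max (\<tau> * \<xi> (t - m)) (\<zeta> (t - m + 1))"
begin

abbreviation "feas t \<equiv> Pm_feasible_set f X U Xf N l \<delta> lf \<gamma> \<beta> (x t) (\<xi> t) (\<zeta> t)"

lemma feasibleD:
  assumes "u t \<in> feas t"
  shows "u t \<in> adm (x t)" "V (x t) (u t) \<le> \<xi> t" "\<zeta> (Suc t) \<le> \<zeta> t"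
  using assms by (auto simp: Pm_feasible_set_def \<zeta>_Suc)

lemma shifted_candidate:
  assumes "u t \<in> adm (x t)"
  shows "shifted (x t) (u t) \<in> adm (x (Suc t))"
    and "V (x (Suc t)) (shifted (x t) (u t)) \<le> \<zeta> (Suc t)"
proof -
  show "shifted (x t) (u t) \<in> adm (x (Suc t))"
    using shifted_admissible[OF assms] by (simp add: closed_loop)
  \<comment> \<open>Here \<open>\<beta> \<le> 1\<close> enters: the guaranteed descent by
    \<open>J\<close> covers the demanded \<open>\<beta> * J\<close>.\<close>
  have "\<beta> * J (x t) (u t) \<le> J (x t) (u t)"
    using J_nonneg[OF assms] \<beta> by (simp add: mult_left_le_one_le)
  then show "V (x (Suc t)) (shifted (x t) (u t)) \<le> \<zeta> (Suc t)"
    using V_shifted_le[OF assms] by (simp add: closed_loop \<zeta>_Suc)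
qed

text \<open>Subtracting \<open>\<beta> * J \<ge> 0\<close> only helps, so bounding \<open>V\<close>
  itself by \<open>\<zeta> t\<close> secures the second constraint.\<close>

lemma feasibleI:
  assumes v: "v \<in> adm (x t)" and "V (x t) v \<le> \<xi> t" "V (x t) v \<le> \<zeta> t"
  shows "v \<in> feas t"
  using assms mult_nonneg_nonneg[OF less_imp_le[OF \<beta>(1)] J_nonneg[OF v]]
  by (auto simp: Pm_feasible_set_def)

lemma recursively_feasible:
  assumes opt: "\<And>s. s < t \<Longrightarrow> u s \<in> feas s"
  shows "feas t \<noteq> {}"
proof (cases t)
  case 0
  obtain v where v: "v \<in> adm (x 0)" using initial by blast
  then have "v \<in> feas 0"
    using m V_le_V_max[OF v] by (intro feasibleI) (auto simp: \<zeta>_0 \<xi>_initial)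
  then show ?thesis using 0 by blast
next
  case (Suc s)
  define v where "v = shifted (x s) (u s)"
  have v: "v \<in> adm (x t)" "V (x t) v \<le> \<zeta> t"
    using shifted_candidate[of s] feasibleD(1)[OF opt, of s] Suc by (auto simp: v_def)
  \<comment> \<open>The second constraint at time \<open>n\<close> reads
    \<open>\<zeta> (Suc n) \<le> \<zeta> n\<close>; as feasibility is assumed only before
    \<open>t\<close>, monotonicity is claimed only up to \<open>t\<close>.\<close>
  have antitone: "\<zeta> t \<le> \<zeta> r" if "r \<le> t" for r
    using that
  proof (induction rule: inc_induct)
    case (step n)
    then show ?case using feasibleD(3)[OF opt[of n]] by simp
  qed simp
  have "V (x t) v \<le> \<xi> t"
  proof (cases "t < m")
    case True
    then show ?thesis using V_le_V_max[OF v(1)] by (simp add: \<xi>_initial)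
  next
    case False
    then have "\<zeta> t \<le> \<zeta> (t - m + 1)" using m by (intro antitone) auto
    then show ?thesis using v(2) \<xi>_delayed[of t] False by simp
  qed
  then show ?thesis using feasibleI[OF v(1)] v(2) by blast
qed

lemma J_tendsto_zero:
  assumes feas: "\<And>t. u t \<in> feas t"
  shows "(\<lambda>t. J (x t) (u t)) \<longlonglongrightarrow> 0"
proof -
  note D = feasibleD[OF feas]
  have "decseq \<zeta>" using D(3) by (intro decseq_SucI)
  \<comment> \<open>The shifted candidate has nonnegative cost below
    \<open>\<zeta> (Suc t)\<close>.\<close>
  moreover have \<zeta>_nonneg: "0 \<le> \<zeta> (Suc t)" for t
    using shifted_candidate[OF D(1)[of t]] V_nonneg by (meson order_trans)
  moreover have "0 \<le> \<zeta> t" for t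
    using \<zeta>_nonneg[of t] D(3)[of t] by linarith
  ultimately obtain z where z: "\<zeta> \<longlonglongrightarrow> z" "\<And>t. z \<le> \<zeta> t"
    using decseq_convergent[of \<zeta> 0] by metis
  have "0 \<le> z" using z(1) \<open>\<And>t. 0 \<le> \<zeta> t\<close> by (intro LIMSEQ_le_const) auto
  have \<zeta>_V: "\<zeta> (Suc t) \<le> V (x t) (u t)" for t
    using mult_nonneg_nonneg[OF less_imp_le[OF \<beta>(1)] J_nonneg[OF D(1)[of t]]]
    by (simp add: \<zeta>_Suc)
  have V: "(\<lambda>t. V (x t) (u t)) \<longlonglongrightarrow> z"
  proof (rule order_tendstoI)
    fix a assume "a < z"
    then show "eventually (\<lambda>t. a < V (x t) (u t)) sequentially"
      using z(2) \<zeta>_V by (intro always_eventually allI) (meson less_le_trans order_trans)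
  next
    fix a assume "z < a"
    then have "eventually (\<lambda>t. \<xi> t < a) sequentially"
      using delayed_max_recursion_eventually_less[OF \<xi>_delayed _ \<tau> z(1)] m \<open>0 \<le> z\<close> by auto
    then show "eventually (\<lambda>t. V (x t) (u t) < a) sequentially"
      by eventually_elim (use D(2) le_less_trans in blast)
  qed
  \<comment> \<open>By the update rule this quotient is exactly
    \<open>J (x t) (u t)\<close>.\<close>
  have "(\<lambda>t. (V (x t) (u t) - \<zeta> (Suc t)) / \<beta>) \<longlonglongrightarrow> (z - z) / \<beta>"
    using V z(1) \<beta> by (intro tendsto_intros) (auto simp: LIMSEQ_Suc)
  then show ?thesis using \<beta> by (simp add: \<zeta>_Suc)
qed

end

section \<open>Transfer to the economic scheme\<close>

theorem theorem2:
  fixes f :: "(real ^ 'nx) \<times> (real ^ 'nu) \<Rightarrow> real ^ 'nx"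
    and le l \<delta> :: "(real ^ 'nx) \<times> (real ^ 'nu) \<Rightarrow> real"
    and lf \<gamma> :: "real ^ 'nx \<Rightarrow> real"
    and X Xinf Xf :: "(real ^ 'nx) set" and U :: "(real ^ 'nu) set"
    and xs :: "real ^ 'nx" and us :: "real ^ 'nu"
    and \<kappa> :: "real ^ 'nx \<Rightarrow> real ^ 'nu"
    and N m :: nat and \<beta> \<tau> :: real
    and x :: "nat \<Rightarrow> real ^ 'nx" and uopt :: "nat \<Rightarrow> nat \<Rightarrow> real ^ 'nu"
    and \<xi> \<zeta> :: "nat \<Rightarrow> real"
  assumes "continuous_on UNIV f" and "continuous_on UNIV le"
    and "compact X" and "compact U" and "Xinf \<subseteq> X"
    and "is_arg_min le (\<lambda>(y, v). y = f (y, v) \<and> y \<in> Xinf \<and> v \<in> U) (xs, us)"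
    and "xs \<in> interior X" and "us \<in> interior U"
    and "compact Xf" and "Xf \<subseteq> X" and "xs \<in> interior Xf"
    and "\<forall>y\<in>X. \<kappa> y \<in> U" and "\<kappa> xs = us"
    and "\<forall>y\<in>Xf. f (y, \<kappa> y) \<in> Xf \<and> \<kappa> y \<in> U"
    and "N \<ge> 1"
    and "positive_definite_on (X \<times> U) l (xs, us)"
    and "positive_definite_on (X \<times> U) \<delta> (xs, us)"
    and "positive_definite_on Xf lf xs"
    and "positive_definite_on X \<gamma> xs"
    and "\<forall>y\<in>Xf. lf (f (y, \<kappa> y)) - lf y
            \<le> - l (y, \<kappa> y) - (real N - 1) * \<delta> (y, \<kappa> y) - \<gamma> y"
    and "m > 1" and "0 < \<beta>" and "\<beta> \<le> 1" and "0 \<le> \<tau>" and "\<tau> < 1"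
    and "admissible f X U Xf N (x 0) \<noteq> {}"
    and "\<forall>t. x (Suc t) = f (x t, uopt t 0)"
    and "\<zeta> 0 = V_max f X U Xf N l \<delta> lf"
    and "\<forall>t<m. \<xi> t = V_max f X U Xf N l \<delta> lf"
    and "\<forall>t\<ge>1. \<zeta> t = V_delta f N l \<delta> lf (x (t - 1)) (uopt (t - 1))
                      - \<beta> * J_delta f N l \<delta> \<gamma> (x (t - 1)) (uopt (t - 1))"
    and "\<forall>t\<ge>m. \<xi> t = max (\<tau> * \<xi> (t - m)) (\<zeta> (t - m + 1))"
  shows "(\<forall>t. (\<forall>s<t. Pm_optimal f le X U Xf N l \<delta> lf \<gamma> \<beta> (x s) (\<xi> s) (\<zeta> s) (uopt s)) \<longrightarrow>
              Pm_feasible_set f X U Xf N l \<delta> lf \<gamma> \<beta> (x t) (\<xi> t) (\<zeta> t) \<noteq> {}) \<and>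
         ((\<forall>t. Pm_optimal f le X U Xf N l \<delta> lf \<gamma> \<beta> (x t) (\<xi> t) (\<zeta> t) (uopt t)) \<longrightarrow>
            (\<lambda>t. V_delta f N l \<delta> lf (x t) (uopt t)) \<longlonglongrightarrow> 0 \<and>
            (\<lambda>t. J_delta f N l \<delta> \<gamma> (x t) (uopt t)) \<longlonglongrightarrow> 0 \<and>
            x \<longlonglongrightarrow> xs)"
proof -
  interpret tracking_mpc_run f l \<delta> lf \<gamma> X Xf U xs us \<kappa> N m \<beta> \<tau> x uopt \<xi> \<zeta>
  proof
    show "xs \<in> Xf" "us \<in> U" using assms(8,11) interior_subset by blast+
    show "\<zeta> (Suc t) = V_delta f N l \<delta> lf (x t) (uopt t) - \<beta> * J_delta f N l \<delta> \<gamma> (x t) (uopt t)" for t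
      using assms(30) by simp
  qed (rule assms[rule_format]; assumption)+
  \<comment> \<open>A minimizer is in particular feasible; this links the economic problem to the
    tracking argument.\<close>
  have opt: "uopt t \<in> feas t"
    if "Pm_optimal f le X U Xf N l \<delta> lf \<gamma> \<beta> (x t) (\<xi> t) (\<zeta> t) (uopt t)" for t
    using that by (simp add: Pm_optimal_def is_arg_min_def)
  show ?thesis
  proof (intro conjI allI impI)
    fix t
    assume "\<forall>s<t. Pm_optimal f le X U Xf N l \<delta> lf \<gamma> \<beta> (x s) (\<xi> s) (\<zeta> s) (uopt s)"
    then show "feas t \<noteq> {}" using opt by (intro recursively_feasible) blast
  next
    assume "\<forall>t. Pm_optimal f le X U Xf N l \<delta> lf \<gamma> \<beta> (x t) (\<xi> t) (\<zeta> t) (uopt t)"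
    then have feas: "uopt t \<in> feas t" for t using opt by blast
    show J: "(\<lambda>t. J_delta f N l \<delta> \<gamma> (x t) (uopt t)) \<longlonglongrightarrow> 0"
      by (rule J_tendsto_zero[OF feas])
    show "(\<lambda>t. V_delta f N l \<delta> lf (x t) (uopt t)) \<longlonglongrightarrow> 0" "x \<longlonglongrightarrow> xs"
      using J_tendsto_zero_imp[OF feasibleD(1)[OF feas] J] by blast+
  qed
qed

end
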